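(* Let $G$ be a finite graph and let $f:\mathbb{R}\to\mathbb{R}$ be a non-constant odd polynomial. Let $\mathrm{H}_1(G)$ be the first homology group of $G$ over $\mathbb{R}$. Let $C_1,\ldots,C_p$ be cycle subgraphs of $G$ such that for all $i=1,\ldots,p-1$ the cycle $C_i$ intersects $C_{i+1}$ in exactly one edge, and there are no other edge-intersections among $C_1,\ldots,C_p$ (that is, $E(C_i)\cap E(C_j)=\emptyset$ whenever $|i-j|>1$). Then $$\dim X_{G,f} \leq \dim \mathrm{H}_1(G) - p + 1.$$
   Context: $G$ is a finite simple undirected graph with vertex set $V$. Fix an arbitrary orientation of each edge and let $E\subseteq V\times V$ be the set of oriented edges. The incidence matrix $B:\mathbb{R}^E\to\mathbb{R}^V$ has entries $b_{i,(j,k)}=\delta_{ik}-\delta_{ij}$ (Kronecker delta). Set $\mathrm{H}_0(G)=\mathrm{Ker}(B^{\mathsf T})\subseteq\mathbb{R}^V$ and $\mathrm{H}_1(G)=\mathrm{Ker}(B)\subseteq\mathbb{R}^E$; orthogonal complements are Euclidean. For $f:\mathbb{R}\to\mathbb{R}$ a non-constant odd real-analytic function, let $\mathbf{f}:\mathbb{R}^E\to\mathbb{R}^E$ apply $f$ to each component, and define $$X_{G,f}=\mathbf{f}^{-1}(\mathrm{H}_1(G))\cap \mathrm{H}_1(G)^\perp\subseteq\mathbb{R}^E.$$ This is the set of equilibria, up to translations by $\mathrm{H}_0(G)$, of the system $\dot x_i=\sum_{j\in N(i)}f(x_j-x_i)$, $i\in V$, where $N(i)$ is the set of neighbors of $i$: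 the map $x\mapsto B^{\mathsf T}x$ induces a bijection between equilibria in $\mathbb{R}^V$ modulo $\mathrm{H}_0(G)$ and $X_{G,f}$. The set $X_{G,f}$ is real-analytic, and $\dim X_{G,f}$ is the maximum dimension of a manifold contained in it. *)

theory Defs
  imports "HOL-Homology.Homology" "HOL-Computational_Algebra.Polynomial"
begin

section \<open>Graphs and orientations\<close>

text \<open>
  The vertex set is the whole finite type \<open>'v\<close>. A simple undirected graph is given by
  its set of edges, each edge being the set of its two end points.
\<close>

definition simple_graph :: "'v set set \<Rightarrow> bool" where
  "simple_graph G \<longleftrightarrow> (\<forall>e\<in>G. card e = 2)"

definition orientation :: "'v set set \<Rightarrow> ('v \<times> 'v) set \<Rightarrow> bool" where
  "orientation G E \<longleftrightarrow> bij_betw (\<lambda>(j, k). {j, k}) E G"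

text \<open>A cycle graph, which has no isolated vertices, is identified with its set of edges.\<close>

definition is_cycle :: "'v set set \<Rightarrow> bool" where
  "is_cycle C \<longleftrightarrow> (\<exists>vs. distinct vs \<and> 3 \<le> length vs \<and>
     C = {{vs ! i, vs ! (Suc i mod length vs)} |i. i < length vs})"

definition cycle_subgraph :: "'v set set \<Rightarrow> 'v set set \<Rightarrow> bool" where
  "cycle_subgraph C G \<longleftrightarrow> is_cycle C \<and> C \<subseteq> G"


section \<open>Incidence matrix, homology and equilibria\<close>

text \<open>
  Since \<open>E\<close> is a set and not a type, \<open>\<real>\<^sup>E\<close> is realised as the coordinate subspace of
  \<open>real ^ ('v \<times> 'v)\<close> of vectors vanishing outside \<open>E\<close>, with the inherited inner product.
\<close>

definition edge_space :: "('v::finite \<times> 'v) set \<Rightarrow> (real ^ ('v \<times> 'v)) set" where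
  "edge_space E = {x. \<forall>e. e \<notin> E \<longrightarrow> x $ e = 0}"

definition incidence_matrix :: "('v::finite \<times> 'v) set \<Rightarrow> real ^ ('v \<times> 'v) ^ 'v" where
  "incidence_matrix E =
     (\<chi> i e. if e \<in> E then of_bool (i = snd e) - of_bool (i = fst e) else 0)"

definition H1 :: "('v::finite \<times> 'v) set \<Rightarrow> (real ^ ('v \<times> 'v)) set" where
  "H1 E = {x \<in> edge_space E. incidence_matrix E *v x = 0}"

definition componentwise ::
    "('v::finite \<times> 'v) set \<Rightarrow> (real \<Rightarrow> real) \<Rightarrow> real ^ ('v \<times> 'v) \<Rightarrow> real ^ ('v \<times> 'v)" where
  "componentwise E f x = (\<chi> e. if e \<in> E then f (x $ e) else 0)"

text \<open>The orthogonal complement is taken in \<open>\<real>\<^sup>E\<close>, whence the intersection with \<open>edge_space E\<close>.\<close>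

definition X_set :: "('v::finite \<times> 'v) set \<Rightarrow> (real \<Rightarrow> real) \<Rightarrow> (real ^ ('v \<times> 'v)) set" where
  "X_set E f = {x \<in> edge_space E. componentwise E f x \<in> H1 E} \<inter> (edge_space E \<inter> (H1 E)\<^sup>\<bottom>)"


section \<open>Dimension\<close>

text \<open>
  Topological manifolds of dimension \<open>d\<close>, with the subspace topology. For subsets of
  Euclidean space the Hausdorff and second countability axioms hold automatically. The
  empty set satisfies the predicate for every \<open>d\<close> and is excluded in the definition
  of the dimension.
\<close>

definition manifold_of_dim :: "nat \<Rightarrow> 'a::euclidean_space set \<Rightarrow> bool" where
  "manifold_of_dim d M \<longleftrightarrow>
     (\<forall>x\<in>M. \<exists>U W. x \<in> U \<and> openin (top_of_set M) U \<and> openin (Euclidean_space d) W \<and>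
        top_of_set U homeomorphic_space subtopology (Euclidean_space d) W)"

definition manifold_dims :: "'a::euclidean_space set \<Rightarrow> nat set" where
  "manifold_dims X = {d. \<exists>M. M \<subseteq> X \<and> M \<noteq> {} \<and> manifold_of_dim d M}"

definition set_dim :: "'a::euclidean_space set \<Rightarrow> nat" where
  "set_dim X = Max (manifold_dims X)"

text \<open>
  The maximum is meaningful: for nonempty \<open>X\<close> it is taken over a finite nonempty set. The
  set \<open>X_set E f\<close> contains the origin when \<open>f\<close> is odd.
\<close>

lemma manifold_dims_le_DIM:
  fixes X :: "'a::euclidean_space set"
  assumes "d \<in> manifold_dims X"
  shows "d \<le> DIM('a)"
proof (rule ccontr)
  define n where "n = DIM('a)"
  assume "\<not> d \<le> DIM('a)"
  hence nd: "n < d" by (simp add: n_def)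
  obtain M and x :: 'a where M: "x \<in> M" "manifold_of_dim d M"
    using assms unfolding manifold_dims_def by blast
  then obtain U W where UW: "x \<in> U" "openin (Euclidean_space d) W"
    "top_of_set U homeomorphic_space subtopology (Euclidean_space d) W"
    unfolding manifold_of_dim_def by blast
  have Wsub: "W \<subseteq> topspace (Euclidean_space d)"
    using UW(2) by (rule openin_subset)
  obtain g h where hom: "homeomorphic_maps (top_of_set U) (subtopology (Euclidean_space d) W) h g"
    using UW(3) by (auto simp: homeomorphic_space_def)
  have g_cont: "continuous_map (subtopology (Euclidean_space d) W) (top_of_set U) g"
    and hx: "h x \<in> W" and hg: "\<And>y. y \<in> W \<Longrightarrow> h (g y) = y"
  proof -
    have m: "continuous_map (top_of_set U) (subtopology (Euclidean_space d) W) h"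
      "continuous_map (subtopology (Euclidean_space d) W) (top_of_set U) g"
      "\<forall>y\<in>topspace (subtopology (Euclidean_space d) W). h (g y) = y"
      using hom unfolding homeomorphic_maps_def by blast+
    have t: "topspace (subtopology (Euclidean_space d) W) = W"
      using Wsub by (simp add: inf_absorb2)
    show "continuous_map (subtopology (Euclidean_space d) W) (top_of_set U) g" by (rule m)
    show "h x \<in> W"
      using continuous_map_image_subset_topspace[OF m(1)] UW(1) t by auto
    show "\<And>y. y \<in> W \<Longrightarrow> h (g y) = y" using m(3) t by simp
  qed
  obtain b :: "nat \<Rightarrow> 'a" where b: "bij_betw b {..<n} Basis"
    using ex_bij_betw_nat_finite[OF finite_Basis] by (metis n_def atLeast0LessThan)
  define \<phi> :: "'a \<Rightarrow> nat \<Rightarrow> real" where "\<phi> = (\<lambda>x i. if i < n then x \<bullet> b i else 0)"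
  have phi_cont: "continuous_map euclidean (Euclidean_space d) \<phi>"
  proof -
    have "\<phi> = (\<lambda>x i. if i < d then if i < n then x \<bullet> b i else 0 else 0)"
      using nd by (auto simp: \<phi>_def fun_eq_iff)
    moreover have "continuous_map euclidean (Euclidean_space d) \<dots>"
      by (subst continuous_map_componentwise_Euclidean_space) (auto intro!: continuous_intros)
    ultimately show ?thesis by simp
  qed
  have phi_inj: "inj \<phi>"
  proof
    fix x y :: 'a assume eq: "\<phi> x = \<phi> y"
    have "x \<bullet> c = y \<bullet> c" if "c \<in> Basis" for c
    proof -
      have "c \<in> b ` {..<n}" using b that by (simp add: bij_betw_def)
      then obtain i where "i < n" "c = b i" by auto
      thus ?thesis using fun_cong[OF eq, of i] by (simp add: \<phi>_def)
    qed
    thus "x = y" by (rule euclidean_eqI)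
  qed
  have cont: "continuous_map (subtopology (Euclidean_space d) W) (Euclidean_space d) (\<phi> \<circ> g)"
    using continuous_map_compose[OF continuous_map_into_fulltopology[OF g_cont] phi_cont] .
  have inj: "inj_on (\<phi> \<circ> g) W"
  proof (rule inj_onI)
    fix u v assume uv: "u \<in> W" "v \<in> W" "(\<phi> \<circ> g) u = (\<phi> \<circ> g) v"
    hence "g u = g v" using phi_inj by (simp add: inj_eq)
    thus "u = v" using hg uv by metis
  qed
  have op: "openin (Euclidean_space d) ((\<phi> \<circ> g) ` W)"
    using invariance_of_domain_Euclidean_space[OF UW(2) cont inj] .
  define z where "z = (\<phi> \<circ> g) (h x)"
  define \<gamma> :: "real \<Rightarrow> nat \<Rightarrow> real" where "\<gamma> = (\<lambda>t i. if i = n then t else z i)"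
  have z0: "z i = 0" if "i \<ge> n" for i using that by (simp add: z_def \<phi>_def)
  have g_cont: "continuous_map euclidean (Euclidean_space d) \<gamma>"
  proof -
    have "\<gamma> = (\<lambda>t i. if i < d then if i = n then t else z i else 0)"
      using nd z0 by (auto simp: \<gamma>_def fun_eq_iff)
    moreover have "continuous_map euclidean (Euclidean_space d) \<dots>"
      by (subst continuous_map_componentwise_Euclidean_space) auto
    ultimately show ?thesis by simp
  qed
  have "open {t \<in> topspace euclidean. \<gamma> t \<in> (\<phi> \<circ> g) ` W}"
    using openin_continuous_map_preimage[OF g_cont op] by simp
  moreover have "\<gamma> 0 = z" using z0 by (auto simp: \<gamma>_def)
  hence "0 \<in> {t \<in> topspace euclidean. \<gamma> t \<in> (\<phi> \<circ> g) ` W}"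
    using hx by (auto simp: z_def)
  ultimately obtain e where "e > 0" and e: "ball 0 e \<subseteq> {t. \<gamma> t \<in> (\<phi> \<circ> g) ` W}"
    by (auto elim!: openE)
  hence "\<gamma> (e/2) \<in> (\<phi> \<circ> g) ` W" by (auto simp: subset_iff)
  then have "\<gamma> (e/2) n = 0" by (auto simp: \<phi>_def)
  thus False using \<open>e > 0\<close> by (simp add: \<gamma>_def)
qed

lemma finite_manifold_dims: "finite (manifold_dims (X :: 'a::euclidean_space set))"
proof (rule finite_subset)
  show "manifold_dims X \<subseteq> {..DIM('a)}" using manifold_dims_le_DIM by auto
qed simp

lemma zero_in_manifold_dims:
  assumes "x \<in> X"
  shows "0 \<in> manifold_dims X"
proof -
  have "topspace (Euclidean_space 0) = {\<lambda>i. 0}"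
    by (auto simp: topspace_Euclidean_space)
  hence "top_of_set {x} homeomorphic_space subtopology (Euclidean_space 0) (topspace (Euclidean_space 0))"
    by (auto simp: homeomorphic_space_def homeomorphic_maps_def
             intro!: exI[of _ "\<lambda>_. x"] exI[of _ "\<lambda>_ _. 0"])
  hence "manifold_of_dim 0 {x}"
    unfolding manifold_of_dim_def
    by (metis openin_topspace singletonD topspace_euclidean_subtopology singletonI)
  thus ?thesis using assms unfolding manifold_dims_def by blast
qed

lemma zero_in_X_set:
  assumes "\<And>x. f (- x) = - f x"
  shows "0 \<in> X_set E f"
proof -
  have "f 0 = 0" using assms[of 0] by simp
  hence "componentwise E f 0 = 0" by (simp add: componentwise_def vec_eq_iff)
  thus ?thesis
    by (simp add: X_set_def H1_def edge_space_def orthogonal_comp_def orthogonal_def)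
qed

end

(*
  Let c_i be a vector of H_1(G) supported exactly on the edges of C_i, and let W be the span of
  c_2, ..., c_p, which has dimension p - 1. Cut R^E into finitely many closed pieces on each of
  which f is injective in every coordinate. On one piece a point x of X is determined by the
  class of f(x) in H_1(G)/W: if z = f(x) - f(x') lies in the span of c_{i+1}, ..., c_p, then x and
  x' agree on all edges of C_i except possibly the edge shared with C_{i+1}; as x - x' is
  orthogonal to c_i, they agree there as well, so c_{i+1} does not occur in z. By induction z = 0.
  A nonempty d-manifold in X has a nonempty open subset inside one piece, which therefore injects
  continuously into a space of dimension dim H_1(G) - (p - 1); invariance of domain gives the bound.
*)
theory Submission
  imports Defs
begin

section \<open>Topology: bounding the dimension of a manifold by maps that are injective on closed
  pieces\<close>

text \<open>Remove one closed set at a time: either it contains all of \<open>U\<close>, or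
  \<open>U - A\<close> is still open and nonempty and is covered by the remaining sets.\<close>

lemma nonempty_open_subset_of_finite_closed_cover:
  assumes "finite \<A>" "\<And>A. A \<in> \<A> \<Longrightarrow> closedin T A" "openin T U" "U \<noteq> {}" "U \<subseteq> \<Union>\<A>"
  shows "\<exists>A\<in>\<A>. \<exists>V. openin T V \<and> V \<noteq> {} \<and> V \<subseteq> A \<and> V \<subseteq> U"
  using assms
proof (induction arbitrary: U rule: finite_induct)
  case empty
  then show ?case by simp
next
  case (insert A \<A>)
  show ?case
  proof (cases "U \<subseteq> A")
    case True
    then show ?thesis using insert.prems by blast
  next
    case False
    have "openin T (U - A)"
      using insert.prems by (intro openin_diff) auto
    moreover have "U - A \<noteq> {}" "U - A \<subseteq> \<Union>\<A>"
      using False insert.prems by auto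
    ultimately obtain B V where "B \<in> \<A>" "openin T V" "V \<noteq> {}" "V \<subseteq> B" "V \<subseteq> U - A"
      using insert.IH[of "U - A"] insert.prems by auto
    then show ?thesis by blast
  qed
qed

text \<open>\<open>Euclidean_space d\<close> consists of functions on \<open>nat\<close>, whereas
  \<open>invariance_of_dimension_subspaces\<close> speaks of subspaces of a Euclidean type. The
  proof therefore moves \<open>W\<close> to a coordinate subspace of \<open>'b\<close>;
  \<open>d \<le> DIM('b)\<close> leaves room for it.\<close>

lemma Euclidean_space_inj_dim_le:
  fixes f :: "(nat \<Rightarrow> real) \<Rightarrow> 'b::euclidean_space"
  assumes W: "openin (Euclidean_space d) W" "W \<noteq> {}" and d: "d \<le> DIM('b)"
    and f: "continuous_map (subtopology (Euclidean_space d) W) euclidean f" "inj_on f W"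
    and V: "subspace V" "f ` W \<subseteq> V"
  shows "d \<le> dim V"
proof -
  obtain b :: "nat \<Rightarrow> 'b" where b: "bij_betw b {..<DIM('b)} Basis"
    using ex_bij_betw_nat_finite[OF finite_Basis] by (metis atLeast0LessThan)
  define \<phi> :: "'b \<Rightarrow> nat \<Rightarrow> real" where "\<phi> = (\<lambda>x i. if i < d then x \<bullet> b i else 0)"
  define S where "S = span (b ` {..<d})"
  have bB: "b i \<in> Basis" if "i < d" for i
    using b that d by (auto simp: bij_betw_def)
  have inj: "inj_on b {..<d}"
    using b d by (auto simp: bij_betw_def intro: inj_on_subset)
  have dimS: "dim S = d"
  proof -
    have "independent (b ` {..<d})"
      using bB by (intro independent_mono[OF independent_Basis]) auto
    then show ?thesis
      unfolding S_def dim_span using inj by (simp add: dim_eq_card_independent card_image)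
  qed
  have phi_cont: "continuous_map euclidean (Euclidean_space d) \<phi>"
    unfolding \<phi>_def
    by (subst continuous_map_componentwise_Euclidean_space) (auto intro!: continuous_intros)
  define \<psi> where "\<psi> = (\<lambda>v. \<Sum>j<d. v j *\<^sub>R b j)"
  have bb: "b j \<bullet> b i = (if i = j then 1 else 0)" if "i < d" "j < d" for i j
    using bB that inj by (auto simp: inner_Basis inj_on_def)
  have phi_psi: "\<phi> (\<psi> v) = v" if "v \<in> topspace (Euclidean_space d)" for v
  proof
    fix i
    show "\<phi> (\<psi> v) i = v i"
    proof (cases "i < d")
      case True
      have "\<phi> (\<psi> v) i = (\<Sum>j<d. v j * (b j \<bullet> b i))"
        using True by (simp add: \<phi>_def \<psi>_def inner_sum_left)
      also have "\<dots> = (\<Sum>j<d. if i = j then v j else 0)"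
        by (rule sum.cong) (use True in \<open>auto simp: bb\<close>)
      finally show ?thesis using True by simp
    next
      case False
      then show ?thesis using that by (simp add: \<phi>_def topspace_Euclidean_space)
    qed
  qed
  have psi_S: "\<psi> v \<in> S" for v
    unfolding \<psi>_def S_def by (intro span_sum span_scale span_base) auto
  have inj_phi: "inj_on \<phi> S"
  proof (rule inj_onI)
    fix x y assume xy: "x \<in> S" "y \<in> S" "\<phi> x = \<phi> y"
    have "orthogonal (x - y) (b i)" if "i < d" for i
      using that fun_cong[OF xy(3), of i] by (simp add: orthogonal_def inner_diff_left \<phi>_def)
    then have "orthogonal (x - y) (x - y)"
      using orthogonal_to_span[of "x - y" "b ` {..<d}" "x - y"] span_diff xy unfolding S_def by blast
    then show "x = y" by (simp add: orthogonal_self)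
  qed
  \<comment> \<open>The copy of \<open>W\<close> in \<open>S\<close>: on \<open>S\<close> the
    coordinate map \<open>\<phi>\<close> is injective, and \<open>\<psi>\<close> is a right inverse
    of it with values in \<open>S\<close>.\<close>
  define W' where "W' = {x \<in> S. \<phi> x \<in> W}"
  have opW': "openin (top_of_set S) W'"
  proof -
    have "open {x \<in> topspace euclidean. \<phi> x \<in> W}"
      using openin_continuous_map_preimage[OF phi_cont W(1)] by simp
    moreover have "W' = S \<inter> {x \<in> topspace euclidean. \<phi> x \<in> W}"
      by (auto simp: W'_def)
    ultimately show ?thesis by (simp add: openin_open_Int)
  qed
  have "W' \<noteq> {}"
  proof -
    obtain w where "w \<in> W" using W by blast
    moreover from this have "w \<in> topspace (Euclidean_space d)"
      using openin_subset[OF W(1)] by blast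
    ultimately show ?thesis using psi_S phi_psi[of w] unfolding W'_def by (metis (mono_tags, lifting) empty_Collect_eq)
  qed
  moreover have "continuous_on W' (f \<circ> \<phi>)"
  proof -
    have "continuous_map (top_of_set W') (subtopology (Euclidean_space d) W) \<phi>"
      using phi_cont continuous_map_from_subtopology
      by (auto simp: continuous_map_in_subtopology W'_def)
    from continuous_map_compose[OF this f(1)] show ?thesis by simp
  qed
  moreover have "inj_on (f \<circ> \<phi>) W'"
    using f(2) inj_phi by (auto simp: inj_on_def W'_def)
  moreover have "(f \<circ> \<phi>) ` W' \<subseteq> V"
    using V(2) by (auto simp: W'_def)
  ultimately have "dim S \<le> dim V"
    using opW' V(1) by (intro invariance_of_dimension_subspaces[of S W' V "f \<circ> \<phi>"]) (auto simp: S_def)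
  then show ?thesis by (simp add: dimS)
qed

text \<open>The inverse \<open>g\<close> of a chart pulls the closed cover back to the chart domain,
  where some piece contains a nonempty open set; there \<open>F \<circ> g\<close> is injective. As
  \<open>F\<close> stays in the type \<open>'a\<close>, \<open>manifold_dims_le_DIM\<close> supplies
  the room for \<open>d\<close> coordinates.\<close>

lemma manifold_dims_le_of_piecewise_inj:
  fixes F :: "'a::euclidean_space \<Rightarrow> 'a"
  assumes d: "d \<in> manifold_dims X"
    and fin: "finite \<A>" and cl: "\<And>A. A \<in> \<A> \<Longrightarrow> closed A" and cov: "X \<subseteq> \<Union>\<A>"
    and inj: "\<And>A. A \<in> \<A> \<Longrightarrow> inj_on F (X \<inter> A)"
    and F: "continuous_on X F" "F ` X \<subseteq> V" and V: "subspace V"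
  shows "d \<le> dim V"
proof -
  obtain M and x :: 'a where M: "x \<in> M" "manifold_of_dim d M" "M \<subseteq> X"
    using d unfolding manifold_dims_def by blast
  then obtain U W where UW: "x \<in> U" "openin (top_of_set M) U" "openin (Euclidean_space d) W"
    "top_of_set U homeomorphic_space subtopology (Euclidean_space d) W"
    unfolding manifold_of_dim_def by blast
  then obtain g h where hom: "homeomorphic_maps (top_of_set U) (subtopology (Euclidean_space d) W) h g"
    by (auto simp: homeomorphic_space_def)
  define T where "T = subtopology (Euclidean_space d) W"
  have topT: "topspace T = W"
    using openin_subset[OF UW(3)] by (simp add: T_def inf_absorb2)
  have h: "continuous_map (top_of_set U) T h" and g: "continuous_map T (top_of_set U) g"
    and hg: "\<And>y. y \<in> W \<Longrightarrow> h (g y) = y"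
    using hom topT unfolding homeomorphic_maps_def T_def by auto
  have UX: "U \<subseteq> X" using openin_subset[OF UW(2)] M(3) by auto
  have gU: "g y \<in> U" if "y \<in> W" for y
    using continuous_map_image_subset_topspace[OF g] topT that by auto
  have "h x \<in> W"
    using continuous_map_image_subset_topspace[OF h] topT UW(1) by auto
  have g': "continuous_map T euclidean g"
    using g by (simp add: continuous_map_in_subtopology)
  let ?\<A> = "(\<lambda>A. {w \<in> topspace T. g w \<in> A}) ` \<A>"
  have "closedin T B" if "B \<in> ?\<A>" for B
    using that cl closedin_continuous_map_preimage[OF g'] by auto
  moreover have "W \<subseteq> \<Union>?\<A>"
    using gU UX cov topT by fastforce
  moreover have "openin T W" using topT openin_topspace[of T] by simp
  ultimately obtain A W' where A: "A \<in> \<A>" and W': "openin T W'" "W' \<noteq> {}" "W' \<subseteq> W"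
      "W' \<subseteq> {w \<in> topspace T. g w \<in> A}"
    using nonempty_open_subset_of_finite_closed_cover[of ?\<A> T W] fin \<open>h x \<in> W\<close> by blast
  have op: "openin (Euclidean_space d) W'"
    using W'(1) UW(3) by (simp add: T_def openin_open_subtopology)
  have gc: "continuous_map (subtopology (Euclidean_space d) W') (top_of_set X) g"
  proof -
    have "continuous_map (subtopology T W') (top_of_set X) g"
      using g' UX gU W'(3) topT by (auto simp: continuous_map_in_subtopology continuous_map_from_subtopology)
    moreover have "subtopology T W' = subtopology (Euclidean_space d) W'"
      using W'(3) by (simp add: T_def subtopology_subtopology inf_absorb2)
    ultimately show ?thesis by simp
  qed
  show ?thesis
  proof (rule Euclidean_space_inj_dim_le[OF op W'(2) manifold_dims_le_DIM[OF d], of "F \<circ> g"])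
    show "continuous_map (subtopology (Euclidean_space d) W') euclidean (F \<circ> g)"
      using F(1) by (intro continuous_map_compose[OF gc]) simp
    show "inj_on (F \<circ> g) W'"
    proof (rule inj_onI)
      fix u v assume uv: "u \<in> W'" "v \<in> W'" "(F \<circ> g) u = (F \<circ> g) v"
      moreover have "g u \<in> X \<inter> A" "g v \<in> X \<inter> A"
        using uv W' gU UX by blast+
      ultimately have "g u = g v"
        using inj[OF A] by (auto simp: inj_on_def)
      then show "u = v" using hg uv W'(3) by (metis subsetD)
    qed
    show "(F \<circ> g) ` W' \<subseteq> V" using F(2) W' gU UX by fastforce
  qed (rule V)
qed

section \<open>Linear algebra and calculus: quotients and injectivity of polynomials\<close>

text \<open>The quotient of \<open>V\<close> by \<open>W\<close> is realised as the orthogonal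
  complement of \<open>W\<close> inside \<open>V\<close>. The map \<open>\<pi>\<close> subtracts the
  projection onto \<open>W\<close>, so a vector killed by \<open>\<pi>\<close> equals its own
  projection.\<close>

lemma quotient_by_subspace:
  fixes V W :: "'a::euclidean_space set"
  assumes "subspace V" "subspace W" "W \<subseteq> V"
  obtains U and \<pi> :: "'a \<Rightarrow> 'a" where "subspace U" "linear \<pi>" "dim U + dim W = dim V"
    "\<pi> ` V \<subseteq> U" "\<And>v. \<pi> v = 0 \<Longrightarrow> v \<in> W"
proof -
  obtain B where B: "B \<subseteq> W" "pairwise orthogonal B" "span B = W"
    using orthogonal_basis_subspace[OF assms(2)] by metis
  define \<pi> where "\<pi> = (\<lambda>a. a - (\<Sum>b\<in>B. (b \<bullet> a / (b \<bullet> b)) *\<^sub>R b))"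
  define U where "U = {y \<in> V. \<forall>x\<in>W. orthogonal x y}"
  have mem: "(\<Sum>b\<in>B. r b *\<^sub>R b) \<in> W" for r
    using B(1) assms(2) by (intro subspace_sum subspace_scale) auto
  show thesis
  proof
    show "subspace U"
      using assms(1) by (auto simp: U_def subspace_def orthogonal_clauses)
    show "linear \<pi>"
      unfolding \<pi>_def
      by (intro linearI) (simp_all add: inner_add_right add_divide_distrib scaleR_add_left sum.distrib
          scaleR_right_diff_distrib scaleR_sum_right)
    show "dim U + dim W = dim V"
      unfolding U_def using assms by (intro dim_subspace_orthogonal_to_vectors) auto
    show "\<pi> ` V \<subseteq> U"
    proof
      fix y assume "y \<in> \<pi> ` V"
      then obtain a where a: "a \<in> V" "y = \<pi> a" by blast
      have "y \<in> V" using a mem assms by (auto simp: \<pi>_def intro!: subspace_diff)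
      moreover have "orthogonal x y" if "x \<in> W" for x
        unfolding a(2) \<pi>_def using B that by (intro Gram_Schmidt_step) auto
      ultimately show "y \<in> U" by (simp add: U_def)
    qed
    show "v \<in> W" if "\<pi> v = 0" for v
      using that mem[of "\<lambda>b. b \<bullet> v / (b \<bullet> b)"] by (simp add: \<pi>_def)
  qed
qed

text \<open>If \<open>a\<close> and \<open>b\<close> differed, the mean value theorem would give a
  critical point strictly between them, which the second hypothesis forbids.\<close>

lemma poly_inj_between_critical_points:
  fixes q :: "real poly"
  assumes "poly q a = poly q b" "\<And>s. poly (pderiv q) s = 0 \<Longrightarrow> s \<le> a \<and> s \<le> b \<or> a \<le> s \<and> b \<le> s"
  shows "a = b"
proof -
  have False if ab: "a < b" "poly q a = poly q b"
    "\<And>s. poly (pderiv q) s = 0 \<Longrightarrow> s \<le> a \<and> s \<le> b \<or> a \<le> s \<and> b \<le> s" for a b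
  proof -
    obtain s where "a < s" "s < b" "poly q b - poly q a = (b - a) * poly (pderiv q) s"
      using poly_MVT[OF ab(1), of q] by blast
    then show False using ab(1,2) ab(3)[of s] by auto
  qed
  from this[of a b] this[of b a] show ?thesis
    using assms by (metis linorder_less_linear)
qed

section \<open>Cycle subgraphs as elements of the first homology\<close>

lemma subspace_H1: "subspace (H1 E)"
  by (auto simp: subspace_def H1_def edge_space_def matrix_vector_right_distrib
      matrix_vector_mult_scaleR)

text \<open>Surjectivity of the map to unordered pairs puts at least one direction into
  \<open>E\<close>; injectivity excludes having both.\<close>

lemma orientation_unique_direction:
  assumes "simple_graph G" "orientation G E" "{a, b} \<in> G"
  shows "a \<noteq> b" "(a, b) \<in> E \<longleftrightarrow> (b, a) \<notin> E"
proof -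
  show ab: "a \<noteq> b"
    using assms(1,3) by (auto simp: simple_graph_def)
  have inj: "inj_on (\<lambda>(j, k). {j, k}) E" and im: "(\<lambda>(j, k). {j, k}) ` E = G"
    using assms(2) by (auto simp: orientation_def bij_betw_def)
  obtain j k where "(j, k) \<in> E" "{a, b} = {j, k}"
    using im assms(3) by auto
  then have "(a, b) \<in> E \<or> (b, a) \<in> E"
    by (auto simp: doubleton_eq_iff)
  moreover have "\<not> ((a, b) \<in> E \<and> (b, a) \<in> E)"
    using inj_onD[OF inj, of "(a, b)" "(b, a)"] ab by (auto simp: insert_commute)
  ultimately show "(a, b) \<in> E \<longleftrightarrow> (b, a) \<notin> E" by blast
qed

text \<open>Two different positions could give the same edge only if each were the cyclic successor
  of the other, which a length of at least 3 rules out.\<close>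

lemma cyclic_edge_eq_iff:
  assumes "distinct vs" "3 \<le> length vs" "i < length vs" "j < length vs"
  shows "{vs ! i, vs ! (Suc i mod length vs)} = {vs ! j, vs ! (Suc j mod length vs)} \<longleftrightarrow> i = j"
proof -
  let ?n = "length vs"
  have l: "Suc i mod ?n < ?n" "Suc j mod ?n < ?n"
    using assms(2) by (auto intro!: mod_less_divisor)
  show ?thesis
    using assms l
    by (auto simp: doubleton_eq_iff nth_eq_iff_index_eq mod_Suc split: if_splits)
qed

text \<open>The vector is the signed sum of the edges met when walking once around the cycle. Its
  boundary cancels cyclically, and no edge is met twice, so no coefficient cancels.\<close>

lemma cycle_vector_exists:
  fixes G :: "'v::finite set set"
  assumes G: "simple_graph G" "orientation G E" and C: "cycle_subgraph C G"
  obtains c where "c \<in> H1 E" "\<And>j k. c $ (j, k) \<noteq> 0 \<longleftrightarrow> (j, k) \<in> E \<and> {j, k} \<in> C"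
proof -
  obtain vs where vs: "distinct vs" "3 \<le> length vs"
    and Ceq: "C = {{vs ! i, vs ! (Suc i mod length vs)} |i. i < length vs}" and CG: "C \<subseteq> G"
    using C unfolding cycle_subgraph_def is_cycle_def by blast
  define n where "n = length vs"
  have n: "n \<ge> 3" using vs by (simp add: n_def)
  define s where "s = (\<lambda>i. vs ! i)"
  define t where "t = (\<lambda>i. vs ! (Suc i mod n))"
  have inC: "{s i, t i} \<in> C" if "i < n" for i
    using that unfolding Ceq s_def t_def n_def by blast
  then have inG: "{s i, t i} \<in> G" if "i < n" for i
    using that CG by blast
  \<comment> \<open>Contribution of the \<open>i\<close>-th step of the walk, from
    \<open>s i\<close> to \<open>t i\<close>: +1 if \<open>E\<close> orients this edge along the
    walk, -1 if against it.\<close>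
  define D :: "nat \<Rightarrow> 'v \<times> 'v \<Rightarrow> real" where
    "D = (\<lambda>i e. if e \<in> E then of_bool (e = (s i, t i)) - of_bool (e = (t i, s i)) else 0)"
  define c :: "real ^ ('v \<times> 'v)" where "c = (\<chi> e. \<Sum>i<n. D i e)"
  \<comment> \<open>The sign in \<open>D\<close> compensates the orientation, so the boundary of a
    step does not depend on \<open>E\<close>.\<close>
  have boundary: "(\<Sum>e\<in>UNIV. incidence_matrix E $ v $ e * D i e) = of_bool (v = t i) - of_bool (v = s i)"
    if i: "i < n" for i v
  proof -
    have E: "s i \<noteq> t i" "(s i, t i) \<in> E \<longleftrightarrow> (t i, s i) \<notin> E"
      using orientation_unique_direction[OF G inG[OF i]] by auto
    let ?g = "\<lambda>e. incidence_matrix E $ v $ e * D i e"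
    have "(\<Sum>e\<in>UNIV. ?g e) = (\<Sum>e\<in>{(s i, t i), (t i, s i)}. ?g e)"
      by (rule sum.mono_neutral_right) (auto simp: D_def)
    then show ?thesis
      using E by (auto simp: D_def incidence_matrix_def)
  qed
  \<comment> \<open>The end points are the starting points shifted by one; the last step wraps
    around to \<open>s 0\<close>.\<close>
  have tsum: "(\<Sum>i<n. of_bool (v = t i) :: real) = (\<Sum>i<n. of_bool (v = s i))" for v
  proof -
    obtain m where m: "n = Suc m" using n by (cases n) auto
    have "(\<Sum>i<n. of_bool (v = t i) :: real) = (\<Sum>i<m. of_bool (v = s (Suc i))) + of_bool (v = s 0)"
      unfolding m sum.lessThan_Suc by (simp add: t_def s_def m)
    also have "\<dots> = (\<Sum>i<n. of_bool (v = s i))"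
      unfolding m by (subst sum.lessThan_Suc_shift) simp
    finally show ?thesis .
  qed
  show thesis
  proof
    have "(incidence_matrix E *v c) $ v = 0" for v
    proof -
      have "(incidence_matrix E *v c) $ v = (\<Sum>e\<in>UNIV. \<Sum>i<n. incidence_matrix E $ v $ e * D i e)"
        by (simp add: matrix_vector_mult_def c_def sum_distrib_left)
      also have "\<dots> = (\<Sum>i<n. \<Sum>e\<in>UNIV. incidence_matrix E $ v $ e * D i e)"
        by (rule sum.swap)
      also have "\<dots> = (\<Sum>i<n. of_bool (v = t i) - of_bool (v = s i))"
        by (rule sum.cong) (use boundary in auto)
      also have "\<dots> = 0" by (simp add: sum_subtractf tsum)
      finally show ?thesis .
    qed
    then show "c \<in> H1 E"
      by (simp add: H1_def edge_space_def vec_eq_iff) (simp add: c_def D_def)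
  next
    fix j k
    have D0: "D i (j, k) = 0" if "{j, k} \<noteq> {s i, t i}" for i
    proof -
      have "(j, k) \<noteq> (s i, t i)" using that by (intro notI) simp
      moreover have "(j, k) \<noteq> (t i, s i)" using that by (intro notI) (simp add: insert_commute)
      ultimately show ?thesis unfolding D_def by (simp only: of_bool_eq if_cancel diff_self)
    qed
    show "c $ (j, k) \<noteq> 0 \<longleftrightarrow> (j, k) \<in> E \<and> {j, k} \<in> C"
    proof (cases "(j, k) \<in> E \<and> {j, k} \<in> C")
      case True
      then obtain i where i: "i < n" "{j, k} = {s i, t i}"
        unfolding Ceq s_def t_def n_def by blast
      have "D l (j, k) = 0" if "l < n" "l \<noteq> i" for l
        using D0[of l] i that cyclic_edge_eq_iff[OF vs, of i l] by (simp add: s_def t_def n_def)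
      then have "(\<Sum>l<n. D l (j, k)) = (\<Sum>l\<in>{i}. D l (j, k))"
        using i(1) by (intro sum.mono_neutral_right) auto
      moreover have "D i (j, k) \<noteq> 0"
      proof -
        have "s i \<noteq> t i" by (rule orientation_unique_direction(1)[OF G inG[OF i(1)]])
        moreover have "j = s i \<and> k = t i \<or> j = t i \<and> k = s i"
          using i(2) by (simp only: doubleton_eq_iff)
        moreover have "(j, k) \<in> E" using True by (rule conjunct1)
        ultimately show ?thesis by (elim disjE conjE) (simp_all add: D_def)
      qed
      ultimately show ?thesis using True by (simp add: c_def)
    next
      case False
      have "D i (j, k) = 0" if "i < n" for i
      proof (cases "(j, k) \<in> E")
        case True
        then have "{j, k} \<noteq> {s i, t i}" using False inC[OF that] by metis
        then show ?thesis by (rule D0)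
      qed (simp add: D_def)
      then show ?thesis using False by (simp add: c_def)
    qed
  qed
qed

lemma span_coordinate_eq_0:
  fixes S :: "(real ^ 'n) set"
  assumes "z \<in> span S" "\<And>v. v \<in> S \<Longrightarrow> v $ e = 0"
  shows "z $ e = 0"
  using assms by (induction rule: span_induct_alt) auto

section \<open>The dimension bound: independence of the cycle vectors and injectivity modulo their
  span\<close>

theorem theorem1p1:
  fixes G :: "'v::finite set set"
    and E :: "('v \<times> 'v) set"
    and q :: "real poly"
    and C :: "nat \<Rightarrow> 'v set set"
    and p :: nat
  assumes "simple_graph G"
    and "orientation G E"
    and "degree q > 0"
    and "\<And>x. poly q (- x) = - poly q x"
    and "\<And>i. i \<in> {1..p} \<Longrightarrow> cycle_subgraph (C i) G"
    and "\<And>i. i \<in> {1..p-1} \<Longrightarrow> card (C i \<inter> C (i + 1)) = 1"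
    and "\<And>i j. i \<in> {1..p} \<Longrightarrow> j \<in> {1..p} \<Longrightarrow> \<bar>int i - int j\<bar> > 1 \<Longrightarrow> C i \<inter> C j = {}"
  shows "int (set_dim (X_set E (poly q))) \<le> int (dim (H1 E)) - int p + 1"
proof -
  have "\<exists>c. c \<in> H1 E \<and> (\<forall>j k. c $ (j, k) \<noteq> 0 \<longleftrightarrow> (j, k) \<in> E \<and> {j, k} \<in> C i)"
    if "i \<in> {1..p}" for i
    using cycle_vector_exists[OF assms(1,2) assms(5)[OF that]] by metis
  then obtain c where c: "\<And>i. i \<in> {1..p} \<Longrightarrow> c i \<in> H1 E"
    and supp: "\<And>i j k. i \<in> {1..p} \<Longrightarrow> c i $ (j, k) \<noteq> 0 \<longleftrightarrow> (j, k) \<in> E \<and> {j, k} \<in> C i"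
    by metis
  \<comment> \<open>The edge shared by consecutive cycles, with its direction in \<open>E\<close>,
    is the only common support of their vectors; it becomes \<open>s i\<close>.\<close>
  have "\<exists>e. c i $ e \<noteq> 0 \<and> c (Suc i) $ e \<noteq> 0 \<and> (\<forall>e'. c i $ e' \<noteq> 0 \<and> c (Suc i) $ e' \<noteq> 0 \<longrightarrow> e' = e)"
    if mem: "i \<in> {1..p-1}" for i
  proof -
    have i: "i \<in> {1..p}" "Suc i \<in> {1..p}" using mem by auto
    obtain a where a: "C i \<inter> C (Suc i) = {a}"
      using assms(6)[OF mem] by (auto simp: card_1_singleton_iff)
    have "a \<in> G" using a assms(5)[OF i(1)] by (auto simp: cycle_subgraph_def)
    then obtain j k where jk: "(j, k) \<in> E" "a = {j, k}"
      using assms(2) by (auto simp: orientation_def bij_betw_def)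
    have "e' = (j, k)" if "c i $ e' \<noteq> 0" "c (Suc i) $ e' \<noteq> 0" for e'
    proof -
      have "e' \<in> E" and "{fst e', snd e'} \<in> C i \<inter> C (Suc i)"
        using that supp[OF i(1), of "fst e'" "snd e'"] supp[OF i(2), of "fst e'" "snd e'"]
        by simp_all
      moreover from this(2) have "{fst e', snd e'} = {j, k}"
        unfolding a jk(2) by (rule singletonD)
      ultimately show ?thesis
        using assms(2) jk(1)
        unfolding orientation_def bij_betw_def inj_on_def split_beta by (metis fst_conv snd_conv)
    qed
    then show ?thesis using supp i jk a by (intro exI[of _ "(j, k)"]) auto
  qed
  then obtain s where s: "\<And>i. i \<in> {1..p-1} \<Longrightarrow> c i $ s i \<noteq> 0"
      "\<And>i. i \<in> {1..p-1} \<Longrightarrow> c (Suc i) $ s i \<noteq> 0"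
    and s_unique: "\<And>i e. i \<in> {1..p-1} \<Longrightarrow> c i $ e \<noteq> 0 \<Longrightarrow> c (Suc i) $ e \<noteq> 0 \<Longrightarrow> e = s i"
    by metis
  have far: "c j $ e = 0" if "i \<in> {1..p}" "j \<in> {Suc (Suc i)..p}" "c i $ e \<noteq> 0" for i j e
    using that supp[of i "fst e" "snd e"] supp[of j "fst e" "snd e"] assms(7)[of i j] by auto
  \<comment> \<open>\<open>W 2\<close> is the space to be divided out, and \<open>W (Suc p)\<close>
    is zero. Vectors of \<open>W (Suc (Suc i))\<close> vanish on the edges of
    \<open>C i\<close>.\<close>
  define W where "W = (\<lambda>i. span (c ` {i..p}))"
  have W_0: "z $ e = 0" if "i \<in> {1..p}" "z \<in> W (Suc (Suc i))" "c i $ e \<noteq> 0" for i z e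
    by (rule span_coordinate_eq_0[OF that(2)[unfolded W_def]]) (use far[OF that(1) _ that(3)] in auto)
  have W_insert: "W i = span (insert (c i) (c ` {Suc i..p}))" if "i \<le> p" for i
    unfolding W_def using that by (simp add: image_insert[symmetric] atLeastAtMost_insertL del: image_insert)
  have dimW: "dim (W i) = Suc p - i" if "2 \<le> i" "i \<le> Suc p" for i
    using that(2,1)
  proof (induction rule: inc_induct)
    case base
    then show ?case by (simp add: W_def)
  next
    case (step i)
    have "c i \<notin> W (Suc i)"
    proof
      assume mem: "c i \<in> W (Suc i)"
      \<comment> \<open>The edge shared with the preceding cycle detects \<open>c i\<close>: all of
        \<open>W (Suc i)\<close> vanishes there, but \<open>c i\<close> does not. This is why the
        count starts at index 2.\<close>
      define m where "m = i - 1"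
      have m: "m \<in> {1..p-1}" "m \<in> {1..p}" "i = Suc m" using step by (auto simp: m_def)
      have "c i $ s m = 0"
        by (rule W_0[OF m(2) mem[unfolded m(3)] s(1)[OF m(1)], folded m(3)])
      then show False using s(2)[OF m(1)] m(3) by simp
    qed
    then show ?case
      using step by (simp add: W_insert dim_insert dim_span) (simp add: W_def dim_span)
  qed
  have W_H1: "W 2 \<subseteq> H1 E"
    unfolding W_def using c by (intro span_minimal subspace_H1) auto
  let ?f = "componentwise E (poly q)"
  let ?X = "X_set E (poly q)"
  have W_subspace: "subspace (W 2)" by (simp add: W_def)
  obtain U and \<pi> :: "real ^ ('v \<times> 'v) \<Rightarrow> real ^ ('v \<times> 'v)" where U:
    "subspace U" "linear \<pi>" "dim U + dim (W 2) = dim (H1 E)"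
    "\<pi> ` H1 E \<subseteq> U" "\<And>v. \<pi> v = 0 \<Longrightarrow> v \<in> W 2"
    by (rule quotient_by_subspace[OF subspace_H1 W_subspace W_H1]) (rule that)
  txt \<open>The piece \<open>A T\<close> prescribes, by \<open>T\<close>, the side of each critical point on which each coordinate lies.\<close>
  define S where "S = {s. poly (pderiv q) s = 0}"
  have "finite S"
    unfolding S_def using assms(3) by (intro poly_roots_finite) (simp add: pderiv_eq_0_iff)
  define A :: "(('v \<times> 'v) \<times> real) set \<Rightarrow> (real ^ ('v \<times> 'v)) set" where
    "A = (\<lambda>T. {x. \<forall>e. \<forall>s\<in>S. if (e, s) \<in> T then s \<le> x $ e else x $ e \<le> s})"
  have cont_nth: "continuous_on M (\<lambda>x. x $ e)" for M :: "(real ^ ('v \<times> 'v)) set" and e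
    by (rule linear_continuous_on[OF bounded_linear_vec_nth])
  have A_closed: "closed (A T)" for T
  proof -
    have "A T = (\<Inter>e. \<Inter>s\<in>S. {x. if (e, s) \<in> T then s \<le> x $ e else x $ e \<le> s})"
      by (auto simp: A_def)
    moreover have "closed {x :: real ^ ('v \<times> 'v). if (e, s) \<in> T then s \<le> x $ e else x $ e \<le> s}" for e s
      by (cases "(e, s) \<in> T") (auto intro!: closed_Collect_le cont_nth)
    ultimately show ?thesis by (simp only:) (intro closed_INT ballI)
  qed
  have A_inj: "x $ e = x' $ e" if "x \<in> A T" "x' \<in> A T" "poly q (x $ e) = poly q (x' $ e)" for x x' T e
  proof (rule poly_inj_between_critical_points[OF that(3)])
    fix s assume "poly (pderiv q) s = 0"
    then have "s \<in> S" by (simp add: S_def)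
    then have "if (e, s) \<in> T then s \<le> x $ e else x $ e \<le> s"
      "if (e, s) \<in> T then s \<le> x' $ e else x' $ e \<le> s"
      using that(1,2) unfolding A_def by blast+
    then show "s \<le> x $ e \<and> s \<le> x' $ e \<or> x $ e \<le> s \<and> x' $ e \<le> s"
      by presburger
  qed
  have inj: "inj_on (\<pi> \<circ> ?f) (?X \<inter> A T)" for T
  proof (rule inj_onI)
    fix x x' assume x: "x \<in> ?X \<inter> A T" and x': "x' \<in> ?X \<inter> A T" and eq: "(\<pi> \<circ> ?f) x = (\<pi> \<circ> ?f) x'"
    define z where "z = ?f x - ?f x'"
    have out: "x $ e = 0" "x' $ e = 0" if "e \<notin> E" for e
      using x x' that unfolding X_set_def edge_space_def by blast+
    have z_0: "x $ e = x' $ e" if "z $ e = 0" for e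
    proof (cases "e \<in> E")
      case True
      then have "poly q (x $ e) = poly q (x' $ e)" using that by (simp add: z_def componentwise_def)
      then show ?thesis using x x' by (intro A_inj[of x T x' e]) auto
    qed (simp add: out)
    have z2: "z \<in> W 2"
      using eq by (intro U(5)) (simp add: z_def linear_diff[OF U(2)])
    have orth: "(\<Sum>e\<in>UNIV. c i $ e * (x $ e - x' $ e)) = 0" if "i \<in> {1..p}" for i
    proof -
      have "c i \<bullet> x = 0" "c i \<bullet> x' = 0"
        using x x' c[OF that] by (auto simp: X_set_def orthogonal_comp_def orthogonal_def)
      then have "c i \<bullet> (x - x') = 0" by (simp add: inner_diff_right)
      then show ?thesis by (simp add: inner_vec_def)
    qed
    \<comment> \<open>The maximum covers \<open>p = 0\<close>, where \<open>Suc p\<close> lies below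
      the starting index but \<open>W 2\<close> is already zero.\<close>
    have "z \<in> W i" if "2 \<le> i" "i \<le> max 2 (Suc p)" for i
      using that
    proof (induction rule: dec_induct)
      case base
      show ?case by (rule z2)
    next
      case (step m)
      \<comment> \<open>To remove \<open>c m\<close> from \<open>z\<close>, test
        \<open>x - x'\<close> against the vector of the preceding cycle.\<close>
      define i where "i = m - 1"
      have i: "i \<in> {1..p-1}" "i \<in> {1..p}" "Suc i \<in> {1..p}" "m = Suc i" using step by (auto simp: i_def)
      have "z \<in> W (Suc i)" using step i by simp
      then obtain a where a: "z - a *\<^sub>R c (Suc i) \<in> W (Suc (Suc i))"
        using W_insert[of "Suc i"] i(3) unfolding W_def by (auto simp: span_breakdown_eq)
      have za: "z $ e = a * c (Suc i) $ e" if "c i $ e \<noteq> 0" for e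
        using W_0[OF i(2) a that] by simp
      \<comment> \<open>On an edge of \<open>C i\<close> other than \<open>s i\<close>,
        \<open>c (Suc i)\<close> vanishes and hence so does \<open>z\<close>. Only the term at
        \<open>s i\<close> is left in the orthogonality relation.\<close>
      have "c i $ e * (x $ e - x' $ e) = 0" if "e \<noteq> s i" for e
        using za[of e] s_unique[OF i(1), of e] z_0[of e] that by (metis eq_iff_diff_eq_0 mult_eq_0_iff)
      then have "(\<Sum>e\<in>UNIV. c i $ e * (x $ e - x' $ e)) = (\<Sum>e\<in>{s i}. c i $ e * (x $ e - x' $ e))"
        by (intro sum.mono_neutral_right) auto
      then have "x $ s i = x' $ s i"
        using orth[OF i(2)] s(1)[OF i(1)] by simp
      then have "z $ s i = 0" by (simp add: z_def componentwise_def)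
      then have "a = 0" using za[OF s(1)[OF i(1)]] s(2)[OF i(1)] by simp
      then show ?case using a i by simp
    qed
    then have "z \<in> W (max 2 (Suc p))" by simp
    then have "z = 0" by (simp add: W_def)
    then show "x = x'" using z_0 by (simp add: vec_eq_iff)
  qed
  have cover: "?X \<subseteq> \<Union>(A ` Pow (UNIV \<times> S))"
  proof
    fix x :: "real ^ ('v \<times> 'v)"
    \<comment> \<open>The pieces overlap where a coordinate is a critical point; this choice puts
      such ties on the upper side.\<close>
    have "x \<in> A {(e, s). s \<in> S \<and> s \<le> x $ e}" unfolding A_def by (simp add: not_le less_imp_le)
    moreover have "{(e, s). s \<in> S \<and> s \<le> x $ e} \<in> Pow (UNIV \<times> S)" by blast
    ultimately show "x \<in> \<Union>(A ` Pow (UNIV \<times> S))" by blast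
  qed
  have cont: "continuous_on ?X (\<pi> \<circ> ?f)"
  proof (rule continuous_on_compose)
    have "continuous_on ?X (\<lambda>x. if e \<in> E then poly q (x $ e) else 0)" for e
      by (cases "e \<in> E") (auto intro!: continuous_intros cont_nth)
    then show "continuous_on ?X ?f"
      unfolding componentwise_def continuous_on_def by (intro ballI tendsto_vec_lambda) blast
    show "continuous_on (?f ` ?X) \<pi>"
      using U(2) by (simp add: linear_continuous_on linear_conv_bounded_linear)
  qed
  \<comment> \<open>Oddness puts the origin into \<open>?X\<close>, so the maximum is over a
    nonempty finite set and is attained.\<close>
  have "set_dim ?X \<in> manifold_dims ?X"
    unfolding set_dim_def
    using zero_in_manifold_dims[OF zero_in_X_set[of "poly q" E, OF assms(4)]] finite_manifold_dims
    by (intro Max_in) auto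
  then have "set_dim ?X \<le> dim U"
  proof (rule manifold_dims_le_of_piecewise_inj)
    show "finite (A ` Pow (UNIV \<times> S))" using \<open>finite S\<close> by simp
    show "(\<pi> \<circ> ?f) ` ?X \<subseteq> U" using U(4) by (auto simp: X_set_def)
  qed (use A_closed inj cover cont U(1) in blast)+
  \<comment> \<open>For \<open>p = 0\<close> the truncated difference is 0, which still suffices for
    the integer bound.\<close>
  moreover have "dim (W 2) \<ge> p - 1"
    using dimW[of 2] by (cases "p \<ge> 1") auto
  ultimately show ?thesis using U(3) by linarith
qed

end
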